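(* Let $(\Omega,\sigma)$ be a minimal continuous flow on a compact metric space, let $a,b:\Omega\to\mathbb{R}$ be continuous, and let $g:\Omega\times\mathbb{R}\to\mathbb{R}$ be such that the partial derivative $g_x$ exists, $g$ and $g_x$ are continuous on $\Omega\times\mathbb{R}$, and $\lim_{x\to\pm\infty}g(\omega,x)/x=-\infty$ uniformly on $\Omega$. Let $(\Omega\times\mathbb{R},\tau)$ be the flow induced by the family $x'=a(\omega\cdot t)\,x+b(\omega\cdot t)+g(\omega\cdot t,x)$, $\omega\in\Omega$, and let $\mathcal{A}=\bigcup_{\omega\in\Omega}\big(\{\omega\}\times[\alpha_{\mathcal{A}}(\omega),\beta_{\mathcal{A}}(\omega)]\big)$ be its global attractor. Let $\Omega_c$ be the residual set of common continuity points of $\alpha_{\mathcal{A}}$ and $\beta_{\mathcal{A}}$. Take $\omega_0\in\Omega_c$ and define $$\mathcal{M}^\alpha:=\overline{\{(\omega_0\cdot t,\alpha_{\mathcal{A}}(\omega_0\cdot t)) : t\in\mathbb{R}\}},\qquad \mathcal{M}^\beta:=\overline{\{(\omega_0\cdot t,\beta_{\mathcal{A}}(\omega_0\cdot t)) : t\in\mathbb{R}\}}$$ (closures in $\Omega\times\mathbb{R}$). Then: (i) $\mathcal{M}^\alpha$ and $\mathcal{M}^\beta$ are $\tau$-minimal sets and, for any $\omega\in\Omega_c$, the sections $(\mathcal{M}^\alpha)_\omega$ and $(\mathcal{M}^\beta)_\omega$ are respectively the singletons $\{\alpha_{\mathcal{A}}(\omega)\}$ and $\{\beta_{\mathcal{A}}(\omega)\}$.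 In addition, any $\tau$-minimal set $\mathcal{M}$ satisfies $\mathcal{M}^\alpha\le\mathcal{M}\le\mathcal{M}^\beta$. (ii) $\mathcal{A}$ is a pinched compact set if and only if there exists $\omega_0\in\Omega_c$ such that $\alpha_{\mathcal{A}}(\omega_0)=\beta_{\mathcal{A}}(\omega_0)$. In this case, $\Omega_c=\{\omega\in\Omega : \alpha_{\mathcal{A}}(\omega)=\beta_{\mathcal{A}}(\omega)\}$.
   Context: Write $\omega\cdot t:=\sigma(t,\omega)$. The induced (local) flow is $\tau(t,\omega,x_0)=(\omega\cdot t,x(t,\omega,x_0))$, where $x(t,\omega,x_0)$ is the maximal solution of the equation corresponding to $\omega$ with $x(0,\omega,x_0)=x_0$. A set is $\tau$-invariant if it is composed of globally defined orbits and is mapped onto itself by $\tau_t$ for all $t\in\mathbb{R}$. A $\tau$-minimal set is a nonempty compact $\tau$-invariant set with no proper nonempty compact $\tau$-invariant subset ($(\Omega,\sigma)$ minimal: $\Omega$ itself is minimal for $\sigma$). Background: under the stated conditions all forward semiorbits are globally defined and bounded, and $\tau$ has a global attractor $\mathcal{A}$, i.e. a compact $\tau$-invariant set with $\lim_{t\to\infty}\mathrm{dist}(\tau_t(\mathcal{C}),\mathcal{A})=0$ (Hausdorff semidistance) for every bounded $\mathcal{C}\subset\Omega\times\mathbb{R}$; $\mathcal{A}$ is the union of all globally defined bounded $\tau$-orbits; it has the displayed form, with $\alpha_{\mathcal{A}}$ lower semicontinuous and $\beta_{\mathcal{A}}$ upper semicontinuous, both being $\tau$-equilibria ($\alpha(\omega\cdot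 t)=x(t,\omega,\alpha(\omega))$ for all $t,\omega$), whose sets of continuity points are residual and $\sigma$-invariant. For $\mathcal{C}\subseteq\Omega\times\mathbb{R}$, $\mathcal{C}_\omega:=\{x : (\omega,x)\in\mathcal{C}\}$. A compact $\tau$-invariant set is pinched if one of its sections is a singleton. For $\tau$-minimal sets, $\mathcal{M}<\mathcal{N}$ means $x<y$ whenever $(\omega,x)\in\mathcal{M}$ and $(\omega,y)\in\mathcal{N}$, and $\mathcal{M}\le\mathcal{N}$ means $\mathcal{M}<\mathcal{N}$ or $\mathcal{M}=\mathcal{N}$ (two different $\tau$-minimal sets are always ordered in this sense). *)

theory Defs
  imports "HOL-Analysis.Analysis"
begin

definition continuous_flow :: "(real \<Rightarrow> 'w::metric_space \<Rightarrow> 'w) \<Rightarrow> bool" where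
  "continuous_flow \<sigma> \<longleftrightarrow>
     continuous_on UNIV (\<lambda>(t, \<omega>). \<sigma> t \<omega>) \<and>
     (\<forall>\<omega>. \<sigma> 0 \<omega> = \<omega>) \<and>
     (\<forall>s t \<omega>. \<sigma> (s + t) \<omega> = \<sigma> s (\<sigma> t \<omega>))"

text \<open>
  A local flow on a type is given by a map \<open>\<phi>\<close> together with the function \<open>D\<close> assigning to
  each point \<open>z\<close> the set of times at which \<open>\<phi> t z\<close> is defined; the value of \<open>\<phi> t z\<close> for
  \<open>t \<notin> D z\<close> is irrelevant. A global flow has \<open>D = (\<lambda>_. UNIV)\<close>.
\<close>

definition flow_invariant :: "('z \<Rightarrow> real set) \<Rightarrow> (real \<Rightarrow> 'z \<Rightarrow> 'z) \<Rightarrow> 'z set \<Rightarrow> bool" where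
  "flow_invariant D \<phi> C \<longleftrightarrow> (\<forall>z\<in>C. D z = UNIV) \<and> (\<forall>t. \<phi> t ` C = C)"

definition minimal_set ::
    "('z::topological_space \<Rightarrow> real set) \<Rightarrow> (real \<Rightarrow> 'z \<Rightarrow> 'z) \<Rightarrow> 'z set \<Rightarrow> bool" where
  "minimal_set D \<phi> M \<longleftrightarrow>
     M \<noteq> {} \<and> compact M \<and> flow_invariant D \<phi> M \<and>
     (\<forall>K. K \<subset> M \<and> K \<noteq> {} \<and> compact K \<longrightarrow> \<not> flow_invariant D \<phi> K)"

text \<open>
  The Hausdorff semidistance is taken in \<open>ennreal\<close> so that suprema of unbounded sets and
  infima over the empty set are \<open>\<infinity>\<close>; in particular the empty set attracts no nonempty set.
\<close>

definition semidist :: "'z::metric_space set \<Rightarrow> 'z set \<Rightarrow> ennreal" where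
  "semidist B C = (SUP b\<in>B. INF c\<in>C. ennreal (dist b c))"

text \<open>For the images \<open>\<phi> t ` C\<close>, \<open>t \<ge> 0\<close>, to make sense, forward semiorbits have to be global.\<close>

definition global_attractor ::
    "('z::metric_space \<Rightarrow> real set) \<Rightarrow> (real \<Rightarrow> 'z \<Rightarrow> 'z) \<Rightarrow> 'z set \<Rightarrow> bool" where
  "global_attractor D \<phi> A \<longleftrightarrow>
     compact A \<and> flow_invariant D \<phi> A \<and>
     (\<forall>C. bounded C \<longrightarrow>
        (\<forall>z\<in>C. {0..} \<subseteq> D z) \<and> ((\<lambda>t. semidist (\<phi> t ` C) A) \<longlongrightarrow> 0) at_top)"

text \<open>
  Solutions \<open>u\<close> of \<open>x' = F (\<sigma> t \<omega>) x\<close> with \<open>u 0 = x\<^sub>0\<close> on an open interval \<open>I\<close> around \<open>0\<close>.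
  The maximal interval is the union of all such \<open>I\<close>. When \<open>F\<close> guarantees uniqueness, all
  solutions agree on the intersections of their intervals, so \<open>max_solution\<close> is the maximal solution
  on \<open>max_interval\<close> (and unspecified outside).
\<close>

definition solution_on ::
    "(real \<Rightarrow> 'w \<Rightarrow> 'w) \<Rightarrow> ('w \<Rightarrow> real \<Rightarrow> real) \<Rightarrow> 'w \<Rightarrow> real \<Rightarrow> real set \<Rightarrow> (real \<Rightarrow> real) \<Rightarrow> bool" where
  "solution_on \<sigma> F \<omega> x\<^sub>0 I u \<longleftrightarrow>
     open I \<and> is_interval I \<and> 0 \<in> I \<and> u 0 = x\<^sub>0 \<and>
     (\<forall>t\<in>I. (u has_real_derivative F (\<sigma> t \<omega>) (u t)) (at t))"

definition max_interval ::
    "(real \<Rightarrow> 'w \<Rightarrow> 'w) \<Rightarrow> ('w \<Rightarrow> real \<Rightarrow> real) \<Rightarrow> 'w \<Rightarrow> real \<Rightarrow> real set" where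
  "max_interval \<sigma> F \<omega> x\<^sub>0 = \<Union>{I. \<exists>u. solution_on \<sigma> F \<omega> x\<^sub>0 I u}"

definition max_solution ::
    "(real \<Rightarrow> 'w \<Rightarrow> 'w) \<Rightarrow> ('w \<Rightarrow> real \<Rightarrow> real) \<Rightarrow> real \<Rightarrow> 'w \<Rightarrow> real \<Rightarrow> real" where
  "max_solution \<sigma> F t \<omega> x\<^sub>0 = (THE v. \<exists>I u. solution_on \<sigma> F \<omega> x\<^sub>0 I u \<and> t \<in> I \<and> v = u t)"

definition skew_domain ::
    "(real \<Rightarrow> 'w \<Rightarrow> 'w) \<Rightarrow> ('w \<Rightarrow> real \<Rightarrow> real) \<Rightarrow> 'w \<times> real \<Rightarrow> real set" where
  "skew_domain \<sigma> F = (\<lambda>(\<omega>, x\<^sub>0). max_interval \<sigma> F \<omega> x\<^sub>0)"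

definition skew_flow ::
    "(real \<Rightarrow> 'w \<Rightarrow> 'w) \<Rightarrow> ('w \<Rightarrow> real \<Rightarrow> real) \<Rightarrow> real \<Rightarrow> 'w \<times> real \<Rightarrow> 'w \<times> real" where
  "skew_flow \<sigma> F t = (\<lambda>(\<omega>, x\<^sub>0). (\<sigma> t \<omega>, max_solution \<sigma> F t \<omega> x\<^sub>0))"

text \<open>The section of \<open>C \<subseteq> \<Omega> \<times> \<real>\<close> over \<open>\<omega>\<close> is the relational image \<open>C `` {\<omega>}\<close>.\<close>

definition pinched ::
    "('w::topological_space \<times> real \<Rightarrow> real set) \<Rightarrow> (real \<Rightarrow> 'w \<times> real \<Rightarrow> 'w \<times> real)
      \<Rightarrow> ('w \<times> real) set \<Rightarrow> bool" where
  "pinched D \<phi> C \<longleftrightarrow>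
     compact C \<and> flow_invariant D \<phi> C \<and> (\<exists>\<omega>. is_singleton (C `` {\<omega>}))"

definition fiber_less :: "('w \<times> real) set \<Rightarrow> ('w \<times> real) set \<Rightarrow> bool" where
  "fiber_less M N \<longleftrightarrow> (\<forall>\<omega> x y. (\<omega>, x) \<in> M \<longrightarrow> (\<omega>, y) \<in> N \<longrightarrow> x < y)"

definition fiber_le :: "('w \<times> real) set \<Rightarrow> ('w \<times> real) set \<Rightarrow> bool" where
  "fiber_le M N \<longleftrightarrow> fiber_less M N \<or> M = N"

definition graph_orbit_closure ::
    "(real \<Rightarrow> 'w::topological_space \<Rightarrow> 'w) \<Rightarrow> ('w \<Rightarrow> real) \<Rightarrow> 'w \<Rightarrow> ('w \<times> real) set" where
  "graph_orbit_closure \<sigma> \<gamma> \<omega>\<^sub>0 = closure {(\<sigma> t \<omega>\<^sub>0, \<gamma> (\<sigma> t \<omega>\<^sub>0)) | t. True}"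

end

theory Submission
  imports Defs
begin

text \<open>
  The coefficients are locally Lipschitz in \<open>x\<close>, uniformly over the compact base. Gronwall's
  inequality therefore gives uniqueness, hence the group law and strictly increasing fibre maps,
  and continuity of every time map \<open>\<tau> t\<close> on a compact invariant set (\<open>\<tau>_continuous_on\<close>).
  After this, only topology and order are used.

  A strictly increasing bijection between the sections of \<open>A\<close> maps endpoints to endpoints, so
  \<open>\<alpha>\<close> and \<open>\<beta>\<close> are equilibria (\<open>equilibrium\<close>) and their graph closures are orbit closures
  of the skew-product flow. At a continuity point \<open>p\<close> of \<open>\<alpha>\<close> the closure of the graph over an orbit
  can only contain \<open>\<alpha> p\<close>. Since the base is minimal, every nonempty compact invariant set meets
  the section over \<open>p\<close>; an invariant subset of the closure of the orbit of \<open>(p, \<alpha> p)\<close> thus contains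
  \<open>(p, \<alpha> p)\<close> and with it the whole closure. This is minimality (\<open>minimal_graph_orbit_closure\<close>).

  A minimal set \<open>M\<close> is bounded and invariant, so it lies in the attractor. If it differs from
  the minimal set over \<open>\<alpha>\<close>, the two are disjoint. Were a point of \<open>M\<close> below one of the other set in
  the same section, then moving both along times at which the base point approaches \<open>p\<close> would
  preserve their order. The upper point would tend to \<open>\<alpha> p\<close>, so every limit of the lower one would
  be at most \<open>\<alpha> p\<close> and, lying in \<open>A\<close>, also at least \<open>\<alpha> p\<close>; the sets would meet
  (\<open>minimal_sets_ordered\<close>). The upper end \<open>\<beta>\<close> is the same case for the reversed order.

  For the pinched case, every selection of a compact set is continuous wherever the section is a
  singleton, so \<open>\<alpha> \<omega> = \<beta> \<omega>\<close> makes \<open>\<omega>\<close> a continuity point of both. Equality then holds along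
  the dense orbit of \<open>\<omega>\<close> and passes by continuity to every common continuity point.
\<close>

section \<open>Gronwall's inequality\<close>

text \<open>
  Squaring \<open>w\<close> avoids differentiating its absolute value: from the hypothesis,
  \<open>(w\<^sup>2)' \<le> (2 * L + 1) * w\<^sup>2 + \<delta>\<^sup>2\<close> by the arithmetic-geometric mean inequality, so that
  \<open>w\<^sup>2 + \<delta>\<^sup>2\<close> times the decaying exponential is nonincreasing.
\<close>

lemma gronwall_square_forward:
  fixes w w' :: "real \<Rightarrow> real"
  assumes "c \<le> d" "0 \<le> L"
    and der: "\<And>r. r \<in> {c..d} \<Longrightarrow> (w has_real_derivative w' r) (at r)"
    and bound: "\<And>r. r \<in> {c..d} \<Longrightarrow> \<bar>w' r\<bar> \<le> L * \<bar>w r\<bar> + \<delta>"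
  shows "(w d)\<^sup>2 + \<delta>\<^sup>2 \<le> ((w c)\<^sup>2 + \<delta>\<^sup>2) * exp ((2 * L + 1) * (d - c))"
proof -
  define h where "h r = ((w r)\<^sup>2 + \<delta>\<^sup>2) * exp (- ((2 * L + 1) * (r - c)))" for r
  have "h d \<le> h c"
  proof (rule DERIV_nonpos_imp_nonincreasing[OF \<open>c \<le> d\<close>])
    fix r assume "c \<le> r" "r \<le> d"
    then have r: "r \<in> {c..d}" by simp
    have D: "(h has_real_derivative
        (2 * w r * w' r - (2 * L + 1) * ((w r)\<^sup>2 + \<delta>\<^sup>2)) * exp (- ((2 * L + 1) * (r - c)))) (at r)"
      unfolding h_def
      by (rule derivative_eq_intros der[OF r] refl | simp add: algebra_simps)+
    have "2 * w r * w' r \<le> 2 * \<bar>w r\<bar> * (L * \<bar>w r\<bar> + \<delta>)"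
    proof -
      have "w r * w' r \<le> \<bar>w r\<bar> * \<bar>w' r\<bar>" by (metis abs_ge_self abs_mult)
      also have "\<dots> \<le> \<bar>w r\<bar> * (L * \<bar>w r\<bar> + \<delta>)"
        by (intro mult_left_mono bound[OF r]) simp
      finally show ?thesis by simp
    qed
    also have "\<dots> = 2 * L * (w r)\<^sup>2 + 2 * \<bar>w r\<bar> * \<delta>"
      by (simp add: algebra_simps power2_eq_square)
    also have "2 * \<bar>w r\<bar> * \<delta> \<le> (w r)\<^sup>2 + \<delta>\<^sup>2"
      using sum_squares_bound[of "\<bar>w r\<bar>" \<delta>] by simp
    finally have "2 * w r * w' r \<le> (2 * L + 1) * (w r)\<^sup>2 + \<delta>\<^sup>2"
      by (simp add: algebra_simps)
    moreover have "0 \<le> 2 * L * \<delta>\<^sup>2" using \<open>0 \<le> L\<close> by simp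
    ultimately have "2 * w r * w' r - (2 * L + 1) * ((w r)\<^sup>2 + \<delta>\<^sup>2) \<le> 0"
      by (simp add: algebra_simps)
    then show "\<exists>y. (h has_real_derivative y) (at r) \<and> y \<le> 0"
      using D by (meson exp_ge_zero mult_nonpos_nonneg)
  qed
  have "(w d)\<^sup>2 + \<delta>\<^sup>2 = h d * exp ((2 * L + 1) * (d - c))"
    by (simp add: h_def mult.assoc flip: exp_add)
  also have "\<dots> \<le> h c * exp ((2 * L + 1) * (d - c))"
    by (intro mult_right_mono \<open>h d \<le> h c\<close>) simp
  finally show ?thesis by (simp add: h_def)
qed

text \<open>
  Backward time follows by reflecting \<open>w\<close>: the hypothesis bounds only the size of \<open>w'\<close>.
\<close>

lemma gronwall_square:
  fixes w w' :: "real \<Rightarrow> real"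
  assumes "0 \<le> L"
    and der: "\<And>r. r \<in> closed_segment c d \<Longrightarrow> (w has_real_derivative w' r) (at r)"
    and bound: "\<And>r. r \<in> closed_segment c d \<Longrightarrow> \<bar>w' r\<bar> \<le> L * \<bar>w r\<bar> + \<delta>"
  shows "(w d)\<^sup>2 + \<delta>\<^sup>2 \<le> ((w c)\<^sup>2 + \<delta>\<^sup>2) * exp ((2 * L + 1) * \<bar>d - c\<bar>)"
proof (cases "c \<le> d")
  case True
  then show ?thesis
    using gronwall_square_forward[OF True \<open>0 \<le> L\<close>, of w w' \<delta>] der bound
    by (simp add: closed_segment_eq_real_ivl)
next
  case False
  have "(w (- (- d)))\<^sup>2 + \<delta>\<^sup>2
      \<le> ((w (- (- c)))\<^sup>2 + \<delta>\<^sup>2) * exp ((2 * L + 1) * (- d - (- c)))"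
  proof (rule gronwall_square_forward[where w = "\<lambda>r. w (- r)" and w' = "\<lambda>r. - w' (- r)"])
    fix r assume "r \<in> {- c..- d}"
    then have r: "- r \<in> closed_segment c d"
      using False by (auto simp: closed_segment_eq_real_ivl)
    have "((\<lambda>r. w (- r)) has_real_derivative w' (- r) * (- 1)) (at r)"
      by (rule DERIV_chain2[where f = w]) (auto intro!: derivative_eq_intros der[OF r])
    then show "((\<lambda>r. w (- r)) has_real_derivative - w' (- r)) (at r)" by simp
    show "\<bar>- w' (- r)\<bar> \<le> L * \<bar>w (- r)\<bar> + \<delta>" using bound[OF r] by simp
  qed (use False \<open>0 \<le> L\<close> in auto)
  then show ?thesis using False by simp
qed

section \<open>Orbit closures of a flow on a compact invariant set\<close>

locale compact_flow =
  fixes D :: "'z::metric_space \<Rightarrow> real set" and \<phi> :: "real \<Rightarrow> 'z \<Rightarrow> 'z" and A :: "'z set"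
  assumes compact: "compact A"
    and invariant: "flow_invariant D \<phi> A"
    and cont: "\<And>t. continuous_on A (\<phi> t)"
    and zero: "\<And>z. z \<in> A \<Longrightarrow> \<phi> 0 z = z"
    and add: "\<And>s t z. z \<in> A \<Longrightarrow> \<phi> (s + t) z = \<phi> s (\<phi> t z)"
begin

abbreviation orbit :: "'z \<Rightarrow> 'z set" where
  "orbit z \<equiv> range (\<lambda>t. \<phi> t z)"

lemma in_orbit_closure: "z \<in> A \<Longrightarrow> z \<in> closure (orbit z)"
  using closure_subset[of "orbit z"] zero[of z] by (metis rangeI subsetD)

lemma orbit_closure_subset:
  assumes "compact K" "flow_invariant D \<phi> K" "z \<in> K"
  shows "closure (orbit z) \<subseteq> K"
proof (rule closure_minimal)
  show "orbit z \<subseteq> K" using assms by (fastforce simp: flow_invariant_def)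
  show "closed K" by (rule compact_imp_closed) fact
qed

lemma orbit_closure_subset_carrier: "z \<in> A \<Longrightarrow> closure (orbit z) \<subseteq> A"
  by (rule orbit_closure_subset[OF compact invariant])

lemma compact_orbit_closure: "z \<in> A \<Longrightarrow> compact (closure (orbit z))"
  using orbit_closure_subset_carrier compact
  by (metis closed_closure closed_Int_compact inf.absorb1)

text \<open>
  Continuity gives only that the time maps send the closure into itself; equality comes from
  inverting each time map by the opposite one.
\<close>

lemma invariant_orbit_closure:
  assumes z: "z \<in> A"
  shows "flow_invariant D \<phi> (closure (orbit z))"
proof -
  let ?C = "closure (orbit z)"
  have sub: "?C \<subseteq> A" by (rule orbit_closure_subset_carrier[OF z])
  have forward: "\<phi> t ` ?C \<subseteq> ?C" for t
  proof -
    have "\<phi> t ` orbit z \<subseteq> orbit z"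
      by (auto simp flip: add[OF z])
    also have "\<dots> \<subseteq> ?C" by (rule closure_subset)
    finally show ?thesis
      by (intro image_closure_subset continuous_on_subset[OF cont sub] closed_closure)
  qed
  have "?C \<subseteq> \<phi> t ` ?C" for t
  proof
    fix y assume y: "y \<in> ?C"
    then have "y = \<phi> t (\<phi> (- t) y)"
      using add[of y t "- t"] zero[of y] sub by auto
    moreover have "\<phi> (- t) y \<in> ?C" using forward y by blast
    ultimately show "y \<in> \<phi> t ` ?C" by blast
  qed
  with forward have "\<phi> t ` ?C = ?C" for t by (simp add: subset_antisym)
  then show ?thesis
    using sub invariant by (auto simp: flow_invariant_def)
qed

lemma minimal_set_eq_orbit_closure:
  assumes M: "minimal_set D \<phi> M" and "M \<subseteq> A" "z \<in> M"
  shows "M = closure (orbit z)"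
proof -
  have "compact M" "flow_invariant D \<phi> M" using M by (auto simp: minimal_set_def)
  then have sub: "closure (orbit z) \<subseteq> M" by (rule orbit_closure_subset) fact
  have z: "z \<in> A" using assms by blast
  have "\<not> closure (orbit z) \<subset> M"
    using M in_orbit_closure[OF z] compact_orbit_closure[OF z] invariant_orbit_closure[OF z]
    unfolding minimal_set_def by (metis empty_iff)
  with sub show ?thesis by blast
qed

lemma minimal_sets_disjoint:
  assumes "minimal_set D \<phi> M" "M \<subseteq> A" "minimal_set D \<phi> N" "N \<subseteq> A" "M \<noteq> N"
  shows "M \<inter> N = {}"
proof (rule ccontr)
  assume "M \<inter> N \<noteq> {}"
  then obtain z where "z \<in> M" "z \<in> N" by blast
  then have "M = closure (orbit z)" "N = closure (orbit z)"
    using minimal_set_eq_orbit_closure[OF assms(1,2)] minimal_set_eq_orbit_closure[OF assms(3,4)]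
    by blast+
  then show False using \<open>M \<noteq> N\<close> by simp
qed

text \<open>
  Minimality needs a test at the base point of the orbit alone, because an invariant compact set
  through \<open>z\<close> swallows the closure of the orbit of \<open>z\<close>.
\<close>

lemma minimal_orbit_closure:
  assumes z: "z \<in> A"
    and rec: "\<And>K. K \<subseteq> closure (orbit z) \<Longrightarrow> K \<noteq> {} \<Longrightarrow> compact K \<Longrightarrow> flow_invariant D \<phi> K \<Longrightarrow> z \<in> K"
  shows "minimal_set D \<phi> (closure (orbit z))"
  unfolding minimal_set_def
proof (intro conjI allI impI notI)
  show "compact (closure (orbit z))" "flow_invariant D \<phi> (closure (orbit z))"
    by (rule compact_orbit_closure[OF z], rule invariant_orbit_closure[OF z])
  show False if "closure (orbit z) = {}" using in_orbit_closure[OF z] that by simp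
  fix K assume K: "K \<subset> closure (orbit z) \<and> K \<noteq> {} \<and> compact K" "flow_invariant D \<phi> K"
  then have "z \<in> K" by (intro rec) auto
  then have "closure (orbit z) \<subseteq> K" using K by (intro orbit_closure_subset) auto
  then show False using K by auto
qed

end

section \<open>Scalar equations over a compact base flow\<close>

locale scalar_family =
  fixes \<sigma> :: "real \<Rightarrow> 'w::metric_space \<Rightarrow> 'w" and F :: "'w \<Rightarrow> real \<Rightarrow> real"
  assumes base_compact: "compact (UNIV :: 'w set)"
    and base_flow: "continuous_flow \<sigma>"
    and F_cont: "continuous_on UNIV (\<lambda>(\<omega>, x). F \<omega> x)"
    and F_lipschitz: "\<And>R. \<exists>L\<ge>0. \<forall>\<omega> x y. \<bar>x\<bar> \<le> R \<longrightarrow> \<bar>y\<bar> \<le> R \<longrightarrow> \<bar>F \<omega> x - F \<omega> y\<bar> \<le> L * \<bar>x - y\<bar>"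
begin

abbreviation \<xi> :: "real \<Rightarrow> 'w \<Rightarrow> real \<Rightarrow> real" where
  "\<xi> t \<omega> x \<equiv> max_solution \<sigma> F t \<omega> x"

abbreviation D :: "'w \<times> real \<Rightarrow> real set" where
  "D \<equiv> skew_domain \<sigma> F"

abbreviation \<tau> :: "real \<Rightarrow> 'w \<times> real \<Rightarrow> 'w \<times> real" where
  "\<tau> \<equiv> skew_flow \<sigma> F"

lemma \<tau>_Pair: "\<tau> t (\<omega>, x) = (\<sigma> t \<omega>, \<xi> t \<omega> x)"
  by (simp add: skew_flow_def)

lemma \<sigma>_zero: "\<sigma> 0 \<omega> = \<omega>" and \<sigma>_add: "\<sigma> (s + t) \<omega> = \<sigma> s (\<sigma> t \<omega>)"
  using base_flow by (auto simp: continuous_flow_def)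

lemma \<sigma>_cont: "continuous_on UNIV (\<lambda>(t, \<omega>). \<sigma> t \<omega>)"
  using base_flow by (auto simp: continuous_flow_def)

lemma \<sigma>_cont_space: "continuous_on S (\<sigma> t)"
proof -
  have "continuous_on S (\<lambda>\<omega>. (\<lambda>(t, \<omega>). \<sigma> t \<omega>) (t, \<omega>))"
    by (rule continuous_on_compose2[OF \<sigma>_cont]) (auto intro!: continuous_intros)
  then show ?thesis by simp
qed

lemma \<sigma>_inj: "\<sigma> t \<omega> = \<sigma> t \<omega>' \<Longrightarrow> \<omega> = \<omega>'"
  by (metis \<sigma>_add \<sigma>_zero add.left_inverse)

text \<open>
  On the compact segment between the two times both solutions stay bounded, so one Lipschitz
  constant serves, and Gronwall with \<open>\<delta> = 0\<close> applies.
\<close>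

lemma solutions_agree:
  assumes u: "\<And>t. t \<in> I \<Longrightarrow> (u has_real_derivative F (\<sigma> t \<omega>) (u t)) (at t)"
    and v: "\<And>t. t \<in> I \<Longrightarrow> (v has_real_derivative F (\<sigma> t \<omega>) (v t)) (at t)"
    and I: "is_interval I" "c \<in> I" "d \<in> I" and eq: "u c = v c"
  shows "u d = v d"
proof -
  let ?J = "closed_segment c d"
  have J: "?J \<subseteq> I"
    using I by (simp add: closed_segment_subset is_interval_convex)
  have "continuous_on ?J u" "continuous_on ?J v"
    using u v J by (meson DERIV_isCont continuous_at_imp_continuous_on subsetD)+
  then have "bounded (u ` ?J \<union> v ` ?J)"
    by (simp add: compact_continuous_image compact_imp_bounded)
  then obtain R where "\<forall>y \<in> u ` ?J \<union> v ` ?J. norm y \<le> R"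
    unfolding bounded_iff by blast
  then have R: "\<bar>u r\<bar> \<le> R" "\<bar>v r\<bar> \<le> R" if "r \<in> ?J" for r
    using that by auto
  obtain L where L: "0 \<le> L"
    "\<And>\<omega> x y. \<bar>x\<bar> \<le> R \<Longrightarrow> \<bar>y\<bar> \<le> R \<Longrightarrow> \<bar>F \<omega> x - F \<omega> y\<bar> \<le> L * \<bar>x - y\<bar>"
    using F_lipschitz[of R] by blast
  have "(u d - v d)\<^sup>2 + 0\<^sup>2 \<le> ((u c - v c)\<^sup>2 + 0\<^sup>2) * exp ((2 * L + 1) * \<bar>d - c\<bar>)"
    by (rule gronwall_square[where w = "\<lambda>r. u r - v r"
          and w' = "\<lambda>r. F (\<sigma> r \<omega>) (u r) - F (\<sigma> r \<omega>) (v r)"])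
       (use L R J in \<open>auto intro!: derivative_eq_intros u v\<close>)
  then show ?thesis using eq by simp
qed

text \<open>
  This justifies the definite description in \<open>max_solution\<close>: uniqueness holds on the
  intersection of the two intervals.
\<close>

lemma max_solution_eq:
  assumes u: "solution_on \<sigma> F \<omega> x I u" and t: "t \<in> I"
  shows "\<xi> t \<omega> x = u t"
  unfolding max_solution_def
proof (rule the_equality)
  show "\<exists>J w. solution_on \<sigma> F \<omega> x J w \<and> t \<in> J \<and> u t = w t" using assms by blast
next
  fix y assume "\<exists>J w. solution_on \<sigma> F \<omega> x J w \<and> t \<in> J \<and> y = w t"
  then obtain J w where w: "solution_on \<sigma> F \<omega> x J w" "t \<in> J" "y = w t" by blast
  have "w t = u t"
  proof (rule solutions_agree[where I = "I \<inter> J" and u = w and v = u and c = 0 and \<omega> = \<omega>])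
    show "is_interval (I \<inter> J)" using u w by (auto simp: solution_on_def is_interval_Int)
  qed (use u w t in \<open>auto simp: solution_on_def\<close>)
  then show "y = u t" using w by simp
qed

lemma global_solution:
  assumes "D (\<omega>, x) = UNIV"
  shows "solution_on \<sigma> F \<omega> x UNIV (\<lambda>t. \<xi> t \<omega> x)"
proof -
  have ex: "\<exists>I u. solution_on \<sigma> F \<omega> x I u \<and> t \<in> I" for t
  proof -
    have "t \<in> \<Union> {I. \<exists>u. solution_on \<sigma> F \<omega> x I u}"
      using assms by (simp add: skew_domain_def max_interval_def)
    then show ?thesis by blast
  qed
  have "\<xi> 0 \<omega> x = x"
  proof -
    obtain I u where "solution_on \<sigma> F \<omega> x I u" "0 \<in> I" using ex by blast
    then show ?thesis using max_solution_eq by (metis solution_on_def)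
  qed
  moreover have "((\<lambda>t. \<xi> t \<omega> x) has_real_derivative F (\<sigma> t \<omega>) (\<xi> t \<omega> x)) (at t)" for t
  proof -
    obtain I u where u: "solution_on \<sigma> F \<omega> x I u" "t \<in> I" using ex by blast
    have "(u has_real_derivative F (\<sigma> t \<omega>) (\<xi> t \<omega> x)) (at t)"
      using u max_solution_eq[OF u] by (simp add: solution_on_def)
    moreover have "open I" using u by (simp add: solution_on_def)
    ultimately show ?thesis
      by (rule has_field_derivative_transform_within_open)
         (use u max_solution_eq[OF u(1)] in auto)
  qed
  ultimately show ?thesis by (simp add: solution_on_def)
qed

lemma \<xi>_zero: "D (\<omega>, x) = UNIV \<Longrightarrow> \<xi> 0 \<omega> x = x"
  using global_solution by (simp add: solution_on_def)

lemma \<xi>_deriv: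
  "D (\<omega>, x) = UNIV \<Longrightarrow> ((\<lambda>t. \<xi> t \<omega> x) has_real_derivative F (\<sigma> t \<omega>) (\<xi> t \<omega> x)) (at t)"
  using global_solution by (simp add: solution_on_def)

lemma \<xi>_add:
  assumes "D (\<omega>, x) = UNIV"
  shows "\<xi> (s + t) \<omega> x = \<xi> s (\<sigma> t \<omega>) (\<xi> t \<omega> x)"
proof -
  have "((\<lambda>s. \<xi> (s + t) \<omega> x) has_real_derivative F (\<sigma> s (\<sigma> t \<omega>)) (\<xi> (s + t) \<omega> x)) (at s)" for s
    using \<xi>_deriv[OF assms, of "s + t"] by (simp add: DERIV_shift \<sigma>_add)
  then have "solution_on \<sigma> F (\<sigma> t \<omega>) (\<xi> t \<omega> x) UNIV (\<lambda>s. \<xi> (s + t) \<omega> x)"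
    by (simp add: solution_on_def)
  then show ?thesis by (simp add: max_solution_eq)
qed

text \<open>
  Two solutions that exchange order would coincide at some time, hence at all times.
\<close>

lemma \<xi>_strict_mono:
  assumes x: "D (\<omega>, x) = UNIV" and y: "D (\<omega>, y) = UNIV" and "x < y"
  shows "\<xi> t \<omega> x < \<xi> t \<omega> y"
proof (rule ccontr)
  assume not: "\<not> ?thesis"
  let ?h = "\<lambda>r. \<xi> r \<omega> x - \<xi> r \<omega> y"
  have cont: "continuous_on UNIV ?h"
    using \<xi>_deriv[OF x] \<xi>_deriv[OF y]
    by (intro continuous_on_diff continuous_at_imp_continuous_on ballI) (meson DERIV_isCont)+
  have "connected (range ?h)" by (rule connected_continuous_image[OF cont]) simp
  moreover have "?h 0 \<in> range ?h" "?h t \<in> range ?h" by blast+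
  moreover have "?h 0 \<le> 0" "0 \<le> ?h t"
    using not \<open>x < y\<close> by (auto simp: \<xi>_zero x y)
  ultimately have "0 \<in> range ?h" by (meson connectedD_interval)
  then obtain r where "\<xi> r \<omega> x = \<xi> r \<omega> y" by auto
  then have "\<xi> 0 \<omega> x = \<xi> 0 \<omega> y"
    by (rule solutions_agree[OF \<xi>_deriv[OF x] \<xi>_deriv[OF y], where I = UNIV and c = r, rotated 3])
       auto
  then show False using \<open>x < y\<close> by (simp add: \<xi>_zero x y)
qed

text \<open>
  Continuous dependence on initial data. All orbits starting in \<open>A\<close> stay in \<open>A\<close>, so their second
  components share a bound \<open>R\<close>, a single Lipschitz constant serves, and the vector field
  along nearby base orbits differs uniformly little on the compact set of times up to \<open>t\<close> and
  values up to \<open>R\<close>. Gronwall turns this difference into a bound on the distance of solutions.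
\<close>

lemma \<tau>_continuous_on:
  assumes "compact A" and inv: "flow_invariant D \<tau> A"
  shows "continuous_on A (\<tau> t)"
proof -
  have dom: "D (\<omega>, x) = UNIV" if "(\<omega>, x) \<in> A" for \<omega> x
    using inv that by (auto simp: flow_invariant_def)
  have stay: "(\<sigma> s \<omega>, \<xi> s \<omega> x) \<in> A" if "(\<omega>, x) \<in> A" for s \<omega> x
    using inv that unfolding flow_invariant_def by (metis \<tau>_Pair imageI)
  have "bounded (snd ` A)"
    using \<open>compact A\<close> by (simp add: compact_imp_bounded bounded_snd)
  then obtain R where "\<forall>y \<in> snd ` A. norm y \<le> R"
    unfolding bounded_iff by blast
  then have R: "\<bar>x\<bar> \<le> R" if "(\<omega>, x) \<in> A" for \<omega> x
    using that by force
  obtain L where L: "0 \<le> L"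
    "\<And>\<omega> x y. \<bar>x\<bar> \<le> R \<Longrightarrow> \<bar>y\<bar> \<le> R \<Longrightarrow> \<bar>F \<omega> x - F \<omega> y\<bar> \<le> L * \<bar>x - y\<bar>"
    using F_lipschitz[of R] by blast
  define K where "K = {- \<bar>t\<bar>..\<bar>t\<bar>} \<times> (UNIV :: 'w set) \<times> {- R..R}"
  define G where "G p = F (\<sigma> (fst p) (fst (snd p))) (snd (snd p))" for p :: "real \<times> 'w \<times> real"
  have "continuous_on K (\<lambda>p. (\<lambda>(t, \<omega>). \<sigma> t \<omega>) (fst p, fst (snd p)))"
    by (rule continuous_on_compose2[OF \<sigma>_cont]) (auto intro!: continuous_intros)
  then have "continuous_on K (\<lambda>p. \<sigma> (fst p) (fst (snd p)))" by simp
  then have "continuous_on K (\<lambda>p. (\<lambda>(\<omega>, x). F \<omega> x) (\<sigma> (fst p) (fst (snd p)), snd (snd p)))"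
    by (intro continuous_on_compose2[OF F_cont]) (auto intro!: continuous_intros)
  then have "continuous_on K G" unfolding G_def by simp
  moreover have "compact K"
    unfolding K_def by (intro compact_Times base_compact) auto
  ultimately have unif: "uniformly_continuous_on K G"
    by (rule compact_uniformly_continuous)
  define C where "C = exp ((2 * L + 1) * \<bar>t\<bar>)"
  have "C > 0" by (simp add: C_def)
  have "continuous_on A (\<lambda>z. \<xi> t (fst z) (snd z))"
    unfolding continuous_on_iff
  proof (intro ballI allI impI)
    fix z and \<epsilon> :: real assume "z \<in> A" "0 < \<epsilon>"
    obtain \<omega> x where z: "z = (\<omega>, x)" by (cases z)
    \<comment> \<open>Gronwall will give \<open>2 * \<delta>\<^sup>2 * C\<close> as a bound for the square of the distance.\<close>
    define \<delta> where "\<delta> = \<epsilon> / sqrt (4 * C)"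
    have "\<delta> > 0" and \<delta>: "4 * C * \<delta>\<^sup>2 = \<epsilon>\<^sup>2"
      using \<open>0 < \<epsilon>\<close> \<open>C > 0\<close> by (auto simp: \<delta>_def power_divide)
    obtain \<eta> where "\<eta> > 0" and \<eta>:
      "\<And>p q. p \<in> K \<Longrightarrow> q \<in> K \<Longrightarrow> dist q p < \<eta> \<Longrightarrow> dist (G q) (G p) < \<delta>"
      using unif \<open>\<delta> > 0\<close> unfolding uniformly_continuous_on_def by metis
    show "\<exists>d>0. \<forall>z'\<in>A. dist z' z < d \<longrightarrow>
        dist (\<xi> t (fst z') (snd z')) (\<xi> t (fst z) (snd z)) < \<epsilon>"
    proof (intro exI[of _ "min \<eta> \<delta>"] conjI ballI impI)
      fix z' assume "z' \<in> A" and close: "dist z' z < min \<eta> \<delta>"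
      obtain \<omega>' x' where z': "z' = (\<omega>', x')" by (cases z')
      have A: "(\<omega>, x) \<in> A" "(\<omega>', x') \<in> A" using \<open>z \<in> A\<close> \<open>z' \<in> A\<close> z z' by auto
      have "dist \<omega>' \<omega> < \<eta>" "dist x' x < \<delta>"
        using close dist_fst_le[of z' z] dist_snd_le[of z' z] by (auto simp: z z')
      let ?w = "\<lambda>r. \<xi> r \<omega>' x' - \<xi> r \<omega> x"
      have "(?w t)\<^sup>2 + \<delta>\<^sup>2 \<le> ((?w 0)\<^sup>2 + \<delta>\<^sup>2) * exp ((2 * L + 1) * \<bar>t - 0\<bar>)"
      proof (rule gronwall_square[where w = ?w
            and w' = "\<lambda>r. F (\<sigma> r \<omega>') (\<xi> r \<omega>' x') - F (\<sigma> r \<omega>) (\<xi> r \<omega> x)"])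
        fix r assume "r \<in> closed_segment 0 t"
        then have r: "r \<in> {- \<bar>t\<bar>..\<bar>t\<bar>}"
          by (auto simp: closed_segment_eq_real_ivl split: if_splits)
        show "(?w has_real_derivative F (\<sigma> r \<omega>') (\<xi> r \<omega>' x') - F (\<sigma> r \<omega>) (\<xi> r \<omega> x)) (at r)"
          by (intro derivative_intros \<xi>_deriv dom A)
        have bd: "\<bar>\<xi> r \<omega> x\<bar> \<le> R" "\<bar>\<xi> r \<omega>' x'\<bar> \<le> R" using stay[OF A(1)] stay[OF A(2)] R by blast+
        have "dist (G (r, \<omega>', \<xi> r \<omega> x)) (G (r, \<omega>, \<xi> r \<omega> x)) < \<delta>"
          by (rule \<eta>) (use r bd \<open>dist \<omega>' \<omega> < \<eta>\<close> in \<open>auto simp: K_def dist_Pair_Pair\<close>)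
        then have "\<bar>F (\<sigma> r \<omega>') (\<xi> r \<omega> x) - F (\<sigma> r \<omega>) (\<xi> r \<omega> x)\<bar> < \<delta>"
          by (simp add: G_def dist_real_def)
        with L(2)[OF bd(2,1), of "\<sigma> r \<omega>'"]
        show "\<bar>F (\<sigma> r \<omega>') (\<xi> r \<omega>' x') - F (\<sigma> r \<omega>) (\<xi> r \<omega> x)\<bar> \<le> L * \<bar>?w r\<bar> + \<delta>"
          by linarith
      qed (use L in auto)
      also have "\<dots> = ((x' - x)\<^sup>2 + \<delta>\<^sup>2) * C"
        by (simp add: C_def \<xi>_zero dom A)
      also have "\<dots> \<le> (2 * \<delta>\<^sup>2) * C"
      proof (intro mult_right_mono)
        have "(x' - x)\<^sup>2 \<le> \<delta>\<^sup>2"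
          using \<open>dist x' x < \<delta>\<close> by (intro abs_le_square_iff[THEN iffD1]) (auto simp: dist_real_def)
        then show "(x' - x)\<^sup>2 + \<delta>\<^sup>2 \<le> 2 * \<delta>\<^sup>2" by simp
      qed (use \<open>C > 0\<close> in simp)
      also have "\<dots> < \<epsilon>\<^sup>2"
        using \<delta> mult_pos_pos[OF \<open>C > 0\<close> zero_less_power[OF \<open>\<delta> > 0\<close>, of 2]]
        by (simp add: algebra_simps)
      finally have "(?w t)\<^sup>2 < \<epsilon>\<^sup>2" using zero_le_power2[of \<delta>] by linarith
      then have "\<bar>?w t\<bar> < \<epsilon>" using \<open>0 < \<epsilon>\<close> by (metis abs_le_square_iff abs_of_pos not_less)
      then show "dist (\<xi> t (fst z') (snd z')) (\<xi> t (fst z) (snd z)) < \<epsilon>"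
        by (simp add: dist_real_def z z')
    qed (use \<open>\<eta> > 0\<close> \<open>\<delta> > 0\<close> in auto)
  qed
  moreover have "continuous_on A (\<lambda>z. \<sigma> t (fst z))"
    by (rule continuous_on_compose2[OF \<sigma>_cont_space[of UNIV]]) (auto intro!: continuous_intros)
  ultimately show ?thesis
    unfolding skew_flow_def by (simp add: case_prod_beta' continuous_on_Pair)
qed

lemma compact_flow_skew:
  assumes "compact A" "flow_invariant D \<tau> A"
  shows "compact_flow D \<tau> A"
proof
  show "\<tau> 0 z = z" if "z \<in> A" for z
    using assms that by (cases z) (auto simp: flow_invariant_def \<tau>_Pair \<sigma>_zero \<xi>_zero)
  show "\<tau> (s + t) z = \<tau> s (\<tau> t z)" if "z \<in> A" for s t z
    using assms that by (cases z) (auto simp: flow_invariant_def \<tau>_Pair \<sigma>_add \<xi>_add)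
qed (use assms \<tau>_continuous_on in auto)

lemma compact_flow_base: "compact_flow (\<lambda>_. UNIV) \<sigma> UNIV"
proof
  show "flow_invariant (\<lambda>_. UNIV) \<sigma> UNIV"
    unfolding flow_invariant_def by (metis \<sigma>_add \<sigma>_zero add.right_inverse surjI)
qed (auto simp: \<sigma>_zero \<sigma>_add \<sigma>_cont_space base_compact)

end

section \<open>Invariant sets over a minimal base\<close>

text \<open>
  The points of \<open>K\<close> whose second component avoids an open neighbourhood of \<open>c\<close> form a compact set.
  Its projection is closed and misses \<open>p\<close>, so \<open>w n\<close> eventually leaves it.
\<close>

lemma singleton_section_tendsto:
  fixes K :: "('a::metric_space \<times> 'b::metric_space) set"
  assumes "compact K" "K `` {p} \<subseteq> {c}" "(w \<longlongrightarrow> p) G" "\<forall>\<^sub>F n in G. (w n, x n) \<in> K"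
  shows "(x \<longlongrightarrow> c) G"
proof (rule topological_tendstoI)
  fix U :: "'b set" assume "open U" "c \<in> U"
  let ?K = "K \<inter> UNIV \<times> (- U)"
  have "compact ?K"
    using \<open>compact K\<close> \<open>open U\<close> by (intro compact_Int_closed closed_Times) auto
  then have "closed (fst ` ?K)"
    by (intro compact_imp_closed compact_continuous_image continuous_intros)
  moreover have "p \<notin> fst ` ?K" using assms(2) \<open>c \<in> U\<close> by auto
  ultimately have "\<forall>\<^sub>F n in G. w n \<in> - fst ` ?K"
    using assms(3) by (intro topological_tendstoD) (auto simp: open_Compl)
  with assms(4) show "\<forall>\<^sub>F n in G. x n \<in> U"
    by eventually_elim force
qed

lemma singleton_section_isCont:
  fixes K :: "('a::metric_space \<times> 'b::metric_space) set"
  assumes "compact K" "K `` {p} \<subseteq> {f p}" "\<And>w. (w, f w) \<in> K"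
  shows "isCont f p"
  unfolding isCont_def
  by (rule singleton_section_tendsto[OF assms(1,2) tendsto_ident_at]) (simp add: assms(3))

text \<open>
  The semidistance from an invariant set to \<open>A\<close> does not change with time, so attraction forces
  it to vanish, and \<open>A\<close> is closed.
\<close>

lemma bounded_invariant_subset_attractor:
  assumes A: "global_attractor D \<phi> A" and "bounded C" and inv: "flow_invariant D \<phi> C"
  shows "C \<subseteq> A"
proof
  fix z assume "z \<in> C"
  have "((\<lambda>t. semidist (\<phi> t ` C) A) \<longlongrightarrow> 0) at_top"
    using A \<open>bounded C\<close> by (auto simp: global_attractor_def)
  then have "((\<lambda>t::real. semidist C A) \<longlongrightarrow> 0) at_top"
    using inv by (simp add: flow_invariant_def)
  then have zero: "semidist C A = 0" by (simp add: tendsto_const_iff)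
  have closed: "closed A" using A by (auto simp: global_attractor_def compact_imp_closed)
  show "z \<in> A"
  proof (rule ccontr)
    assume "z \<notin> A"
    then obtain e where "e > 0" and "ball z e \<subseteq> - A"
      using closed by (meson ComplI open_Compl openE)
    then have e: "e \<le> dist z c" if "c \<in> A" for c
      using that by (meson ComplD mem_ball not_le subsetD)
    have "ennreal e \<le> (INF c\<in>A. ennreal (dist z c))"
      by (rule INF_greatest) (simp add: e ennreal_leI)
    also have "\<dots> \<le> semidist C A"
      unfolding semidist_def by (rule SUP_upper) fact
    finally show False using zero \<open>e > 0\<close> by simp
  qed
qed

locale scalar_skew_flow = scalar_family \<sigma> F
  for \<sigma> :: "real \<Rightarrow> 'w::metric_space \<Rightarrow> 'w" and F +
  fixes A :: "('w \<times> real) set"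
  assumes base_minimal: "minimal_set (\<lambda>_. UNIV) \<sigma> UNIV"
    and A_compact: "compact A"
    and A_invariant: "flow_invariant D \<tau> A"
begin

sublocale skew: compact_flow D \<tau> A
  by (rule compact_flow_skew) (fact A_compact A_invariant)+

sublocale base: compact_flow "\<lambda>_. UNIV" \<sigma> UNIV
  by (rule compact_flow_base)

lemma domain: "(\<omega>, x) \<in> A \<Longrightarrow> D (\<omega>, x) = UNIV"
  using A_invariant by (auto simp: flow_invariant_def)

lemma \<xi>_mem:
  assumes "flow_invariant D \<tau> K" "(\<omega>, x) \<in> K"
  shows "(\<sigma> t \<omega>, \<xi> t \<omega> x) \<in> K"
  using assms unfolding flow_invariant_def by (metis \<tau>_Pair imageI)

lemma base_orbit_dense: "closure (base.orbit \<omega>) = UNIV"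
  using base.minimal_set_eq_orbit_closure[OF base_minimal] by simp

lemma base_orbit_approximates:
  obtains t where "(\<lambda>n. \<sigma> (t n) \<omega>) \<longlonglongrightarrow> p"
proof -
  have "p \<in> closure (base.orbit \<omega>)" by (simp add: base_orbit_dense)
  then obtain w where w: "\<And>n. w n \<in> base.orbit \<omega>" "w \<longlonglongrightarrow> p"
    unfolding closure_sequential by blast
  then have "\<forall>n. \<exists>t. w n = \<sigma> t \<omega>" by blast
  then obtain t where "\<And>n. w n = \<sigma> (t n) \<omega>" by metis
  then have "w = (\<lambda>n. \<sigma> (t n) \<omega>)" by blast
  with w(2) show ?thesis using that by simp
qed

text \<open>
  The projection of an invariant compact set to the base is invariant and compact, hence the
  whole base.
\<close>

lemma section_nonempty:
  assumes "compact K" "K \<noteq> {}" and inv: "flow_invariant D \<tau> K"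
  obtains x where "(\<omega>, x) \<in> K"
proof -
  have "\<sigma> t ` fst ` K = fst ` K" for t
  proof -
    have "\<sigma> t ` fst ` K = fst ` \<tau> t ` K"
      by (force simp: image_image skew_flow_def case_prod_beta)
    then show ?thesis using inv by (simp add: flow_invariant_def)
  qed
  then have "flow_invariant (\<lambda>_. UNIV) \<sigma> (fst ` K)" by (simp add: flow_invariant_def)
  moreover have "compact (fst ` K)"
    using \<open>compact K\<close> by (intro compact_continuous_image continuous_intros)
  ultimately have "fst ` K = UNIV"
    using base_minimal \<open>K \<noteq> {}\<close> unfolding minimal_set_def by blast
  then have "\<omega> \<in> fst ` K" by simp
  then show ?thesis using that by auto
qed

text \<open>
  The sign of the factor \<open>s\<close> selects an order on the fibre. It lets one argument treat both ends of the sections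
  of \<open>A\<close>: multiplication by a negative number reverses the order, and the flow preserves both
  orders.
\<close>

lemma \<xi>_mono_sign:
  assumes "(\<omega>, x) \<in> A" "(\<omega>, y) \<in> A" "s * x \<le> s * y" "s \<noteq> 0"
  shows "s * \<xi> t \<omega> x \<le> s * \<xi> t \<omega> y"
  using \<xi>_strict_mono[OF domain[OF assms(1)] domain[OF assms(2)], of t]
    \<xi>_strict_mono[OF domain[OF assms(2)] domain[OF assms(1)], of t] assms(3,4)
  by (cases x y rule: linorder_cases) (auto simp: mult_le_cancel_left)

text \<open>
  Density of base orbits carries any violation of the order to the section over \<open>p\<close>, where
  extremality of \<open>c\<close> forces \<open>(p, c)\<close> into both minimal sets.
\<close>

lemma minimal_sets_ordered:
  assumes "s \<noteq> 0"
    and P: "minimal_set D \<tau> P" "P \<subseteq> A" "P `` {p} \<subseteq> {c}"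
    and extremal: "\<And>y. (p, y) \<in> A \<Longrightarrow> s * c \<le> s * y"
    and M: "minimal_set D \<tau> M" "M \<subseteq> A" "M \<noteq> P"
    and xy: "(\<omega>, x) \<in> P" "(\<omega>, y) \<in> M"
  shows "s * x < s * y"
proof (rule ccontr)
  assume "\<not> ?thesis"
  then have le: "s * y \<le> s * x" by simp
  have cpt: "compact P" "compact M" and inv: "flow_invariant D \<tau> P" "flow_invariant D \<tau> M"
    using P M by (auto simp: minimal_set_def)
  obtain t where t: "(\<lambda>n. \<sigma> (t n) \<omega>) \<longlonglongrightarrow> p" by (rule base_orbit_approximates)
  let ?X = "\<lambda>n. \<xi> (t n) \<omega> x" and ?Y = "\<lambda>n. \<xi> (t n) \<omega> y"
  have X: "?X \<longlonglongrightarrow> c"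
    by (rule singleton_section_tendsto[OF cpt(1) P(3) t]) (simp add: \<xi>_mem inv xy)
  have "\<forall>n. (\<sigma> (t n) \<omega>, ?Y n) \<in> M" by (simp add: \<xi>_mem inv xy)
  then obtain l r where l: "l \<in> M" "strict_mono r"
    and lim: "((\<lambda>n. (\<sigma> (t n) \<omega>, ?Y n)) \<circ> r) \<longlonglongrightarrow> l"
    by (rule seq_compactE[OF compact_imp_seq_compact[OF cpt(2)],
          of "\<lambda>n. (\<sigma> (t n) \<omega>, ?Y n)"]) auto
  have "(\<lambda>n. \<sigma> (t (r n)) \<omega>) \<longlonglongrightarrow> p"
    using LIMSEQ_subseq_LIMSEQ[OF t l(2)] by (simp add: o_def)
  moreover have "(\<lambda>n. \<sigma> (t (r n)) \<omega>) \<longlonglongrightarrow> fst l"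
    using tendsto_fst[OF lim] by (simp add: o_def)
  ultimately have "fst l = p" by (metis LIMSEQ_unique)
  have Y: "(\<lambda>n. ?Y (r n)) \<longlonglongrightarrow> snd l"
    using tendsto_snd[OF lim] by (simp add: o_def)
  have X': "(\<lambda>n. ?X (r n)) \<longlonglongrightarrow> c"
    using LIMSEQ_subseq_LIMSEQ[OF X l(2)] by (simp add: o_def)
  have "s * snd l \<le> s * c"
    by (rule LIMSEQ_le[OF tendsto_mult_left[OF Y] tendsto_mult_left[OF X']])
       (use \<xi>_mono_sign[OF _ _ le \<open>s \<noteq> 0\<close>] xy P(2) M(2) in blast)
  moreover have "s * c \<le> s * snd l"
    using extremal[of "snd l"] l(1) M(2) \<open>fst l = p\<close> by (metis prod.collapse subsetD)
  ultimately have "snd l = c" using \<open>s \<noteq> 0\<close> by simp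
  then have "(p, c) \<in> M" using l(1) \<open>fst l = p\<close> by (metis prod.collapse)
  moreover have "(p, c) \<in> P"
    using section_nonempty[OF cpt(1) _ inv(1), of p] xy(1) P(3) by blast
  ultimately show False
    using skew.minimal_sets_disjoint[OF P(1,2) M(1,2)] M(3) by blast
qed

end

section \<open>Extremal equilibria of an invariant set\<close>

text \<open>
  For \<open>s = 1\<close> the selection \<open>\<gamma>\<close> is the lower end of the sections of \<open>A\<close>, for \<open>s = - 1\<close> the
  upper end.
\<close>

locale extremal_section = scalar_skew_flow \<sigma> F A
  for \<sigma> :: "real \<Rightarrow> 'w::metric_space \<Rightarrow> 'w" and F A +
  fixes s :: real and \<gamma> :: "'w \<Rightarrow> real"
  assumes s_nonzero: "s \<noteq> 0"
    and \<gamma>_mem: "(\<omega>, \<gamma> \<omega>) \<in> A"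
    and \<gamma>_extremal: "(\<omega>, x) \<in> A \<Longrightarrow> s * \<gamma> \<omega> \<le> s * x"
begin

text \<open>
  The endpoint over \<open>\<sigma> t \<omega>\<close> is the image of some point of \<open>A\<close>, which lies over \<open>\<omega>\<close> because the
  base flow is injective. Monotonicity compares it with the image of the endpoint over \<open>\<omega>\<close>.
\<close>

lemma equilibrium: "\<xi> t \<omega> (\<gamma> \<omega>) = \<gamma> (\<sigma> t \<omega>)"
proof -
  have "(\<sigma> t \<omega>, \<gamma> (\<sigma> t \<omega>)) \<in> \<tau> t ` A"
    using A_invariant \<gamma>_mem by (simp add: flow_invariant_def)
  then obtain \<omega>' y where "(\<omega>', y) \<in> A" "\<sigma> t \<omega>' = \<sigma> t \<omega>" "\<xi> t \<omega>' y = \<gamma> (\<sigma> t \<omega>)"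
    by (auto simp: skew_flow_def)
  then have y: "(\<omega>, y) \<in> A" "\<xi> t \<omega> y = \<gamma> (\<sigma> t \<omega>)" using \<sigma>_inj by auto
  have "s * \<xi> t \<omega> (\<gamma> \<omega>) \<le> s * \<gamma> (\<sigma> t \<omega>)"
    using \<xi>_mono_sign[OF \<gamma>_mem y(1) \<gamma>_extremal[OF y(1)] s_nonzero, of t] y(2) by simp
  moreover have "s * \<gamma> (\<sigma> t \<omega>) \<le> s * \<xi> t \<omega> (\<gamma> \<omega>)"
    by (intro \<gamma>_extremal \<xi>_mem A_invariant \<gamma>_mem)
  ultimately show ?thesis using s_nonzero by simp
qed

lemma graph_orbit_closure_eq: "graph_orbit_closure \<sigma> \<gamma> \<omega> = closure (skew.orbit (\<omega>, \<gamma> \<omega>))"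
  unfolding graph_orbit_closure_def by (simp add: full_SetCompr_eq \<tau>_Pair equilibrium)

text \<open>
  Continuity at \<open>p\<close> leaves \<open>\<gamma> p\<close> as the only limit of graph points over \<open>p\<close>. Some point does
  lie over \<open>p\<close>, since the closure is compact and invariant.
\<close>

lemma section_at_continuity:
  assumes "isCont \<gamma> p"
  shows "graph_orbit_closure \<sigma> \<gamma> \<omega> `` {p} = {\<gamma> p}"
proof -
  let ?P = "graph_orbit_closure \<sigma> \<gamma> \<omega>"
  have "x = \<gamma> p" if "(p, x) \<in> ?P" for x
  proof -
    obtain z where z: "\<And>n. z n \<in> {(\<sigma> t \<omega>, \<gamma> (\<sigma> t \<omega>)) |t. True}" "z \<longlonglongrightarrow> (p, x)"
      using \<open>(p, x) \<in> ?P\<close> unfolding graph_orbit_closure_def closure_sequential by blast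
    have "snd (z n) = \<gamma> (fst (z n))" for n using z(1)[of n] by auto
    then have "(\<lambda>n. \<gamma> (fst (z n))) \<longlonglongrightarrow> x" using tendsto_snd[OF z(2)] by simp
    moreover have "(\<lambda>n. \<gamma> (fst (z n))) \<longlonglongrightarrow> \<gamma> p"
      using isCont_tendsto_compose[OF assms, of "\<lambda>n. fst (z n)"] tendsto_fst[OF z(2)] by simp
    ultimately show ?thesis by (rule LIMSEQ_unique)
  qed
  moreover obtain x where "(p, x) \<in> ?P"
    using section_nonempty[of ?P p] skew.compact_orbit_closure[OF \<gamma>_mem]
      skew.invariant_orbit_closure[OF \<gamma>_mem] skew.in_orbit_closure[OF \<gamma>_mem]
    unfolding graph_orbit_closure_eq by blast
  ultimately show ?thesis by blast
qed

text \<open>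
  Every invariant compact subset meets the section over \<open>p\<close>, which is just \<open>{\<gamma> p}\<close>.
\<close>

lemma minimal_graph_orbit_closure:
  assumes "isCont \<gamma> p"
  shows "minimal_set D \<tau> (graph_orbit_closure \<sigma> \<gamma> p)"
  unfolding graph_orbit_closure_eq
proof (rule skew.minimal_orbit_closure[OF \<gamma>_mem])
  fix K assume K: "K \<subseteq> closure (skew.orbit (p, \<gamma> p))" "K \<noteq> {}" "compact K" "flow_invariant D \<tau> K"
  obtain x where x: "(p, x) \<in> K" using section_nonempty K by metis
  then have "x \<in> graph_orbit_closure \<sigma> \<gamma> p `` {p}"
    using K(1) by (auto simp: graph_orbit_closure_eq)
  then show "(p, \<gamma> p) \<in> K" using x section_at_continuity[OF assms] by simp
qed

lemma graph_orbit_closure_extremal: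
  assumes "isCont \<gamma> p" "minimal_set D \<tau> M" "M \<subseteq> A" "M \<noteq> graph_orbit_closure \<sigma> \<gamma> p"
    and "(\<omega>, x) \<in> graph_orbit_closure \<sigma> \<gamma> p" "(\<omega>, y) \<in> M"
  shows "s * x < s * y"
proof (rule minimal_sets_ordered[OF s_nonzero])
  show "graph_orbit_closure \<sigma> \<gamma> p \<subseteq> A"
    unfolding graph_orbit_closure_eq by (rule skew.orbit_closure_subset_carrier[OF \<gamma>_mem])
  show "graph_orbit_closure \<sigma> \<gamma> p `` {p} \<subseteq> {\<gamma> p}"
    using section_at_continuity[OF assms(1)] by simp
qed (use assms minimal_graph_orbit_closure \<gamma>_extremal in auto)

end

locale fibre_interval_set =
  lower: extremal_section \<sigma> F A 1 \<alpha> + upper: extremal_section \<sigma> F A "-1" \<beta>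
  for \<sigma> :: "real \<Rightarrow> 'w::metric_space \<Rightarrow> 'w" and F A \<alpha> \<beta>
begin

lemma section_bounds: "(\<omega>, x) \<in> A \<Longrightarrow> \<alpha> \<omega> \<le> x \<and> x \<le> \<beta> \<omega>"
  using lower.\<gamma>_extremal[of \<omega> x] upper.\<gamma>_extremal[of \<omega> x] by simp

text \<open>
  Both endpoints are selections of the compact set \<open>A\<close>, whose section over \<open>\<omega>\<close> is a singleton.
\<close>

lemma isCont_if_equal:
  assumes "\<alpha> \<omega> = \<beta> \<omega>"
  shows "isCont \<alpha> \<omega>" "isCont \<beta> \<omega>"
proof -
  have "A `` {\<omega>} \<subseteq> {\<alpha> \<omega>}" using section_bounds[of \<omega>] assms by fastforce
  then show "isCont \<alpha> \<omega>" "isCont \<beta> \<omega>"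
    using assms lower.A_compact lower.\<gamma>_mem upper.\<gamma>_mem
    by (auto intro!: singleton_section_isCont[of A])
qed

text \<open>
  Equilibria that agree at \<open>\<omega>\<close> agree along its orbit, which accumulates at \<open>p\<close>.
\<close>

lemma equal_if_isCont:
  assumes eq: "\<alpha> \<omega> = \<beta> \<omega>" and cont: "isCont \<alpha> p" "isCont \<beta> p"
  shows "\<alpha> p = \<beta> p"
proof -
  obtain t where t: "(\<lambda>n. \<sigma> (t n) \<omega>) \<longlonglongrightarrow> p" by (rule lower.base_orbit_approximates)
  have "\<alpha> (\<sigma> (t n) \<omega>) = \<beta> (\<sigma> (t n) \<omega>)" for n
    by (metis eq lower.equilibrium upper.equilibrium)
  then have "(\<lambda>n. \<alpha> (\<sigma> (t n) \<omega>)) \<longlonglongrightarrow> \<beta> p"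
    using isCont_tendsto_compose[OF cont(2) t] by simp
  with isCont_tendsto_compose[OF cont(1) t] show ?thesis by (rule LIMSEQ_unique)
qed

lemma is_singleton_section_iff: "is_singleton (A `` {\<omega>}) \<longleftrightarrow> \<alpha> \<omega> = \<beta> \<omega>"
proof
  assume "is_singleton (A `` {\<omega>})"
  then obtain x where "A `` {\<omega>} = {x}" by (auto simp: is_singleton_def)
  moreover have "\<alpha> \<omega> \<in> A `` {\<omega>}" "\<beta> \<omega> \<in> A `` {\<omega>}"
    using lower.\<gamma>_mem upper.\<gamma>_mem by auto
  ultimately show "\<alpha> \<omega> = \<beta> \<omega>" by simp
next
  assume "\<alpha> \<omega> = \<beta> \<omega>"
  then have "A `` {\<omega>} = {\<alpha> \<omega>}"
    using section_bounds[of \<omega>] lower.\<gamma>_mem[of \<omega>] by fastforce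
  then show "is_singleton (A `` {\<omega>})" by simp
qed

lemma pinched_iff: "pinched lower.D lower.\<tau> A \<longleftrightarrow> (\<exists>\<omega>. \<alpha> \<omega> = \<beta> \<omega>)"
  using lower.A_compact lower.A_invariant by (simp add: pinched_def is_singleton_section_iff)

end

section \<open>The structure theorem\<close>

theorem theorem3p3:
  fixes \<sigma> :: "real \<Rightarrow> 'w::metric_space \<Rightarrow> 'w"
    and a b :: "'w \<Rightarrow> real"
    and g g\<^sub>x :: "'w \<times> real \<Rightarrow> real"
    and F :: "'w \<Rightarrow> real \<Rightarrow> real"
    and D :: "'w \<times> real \<Rightarrow> real set"
    and \<tau> :: "real \<Rightarrow> 'w \<times> real \<Rightarrow> 'w \<times> real"
    and A :: "('w \<times> real) set"
    and \<alpha> \<beta> :: "'w \<Rightarrow> real"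
    and \<Omega>\<^sub>c :: "'w set"
  assumes "compact (UNIV :: 'w set)"
    and "continuous_flow \<sigma>"
    and "minimal_set (\<lambda>_. UNIV) \<sigma> (UNIV :: 'w set)"
    and "continuous_on UNIV a" and "continuous_on UNIV b"
    and "\<forall>\<omega> x. ((\<lambda>y. g (\<omega>, y)) has_real_derivative g\<^sub>x (\<omega>, x)) (at x)"
    and "continuous_on UNIV g" and "continuous_on UNIV g\<^sub>x"
    and "\<forall>K. \<forall>\<^sub>F x in at_top. \<forall>\<omega>. g (\<omega>, x) / x \<le> K"
    and "\<forall>K. \<forall>\<^sub>F x in at_bot. \<forall>\<omega>. g (\<omega>, x) / x \<le> K"
    and "F = (\<lambda>\<omega> x. a \<omega> * x + b \<omega> + g (\<omega>, x))"
    and "D = skew_domain \<sigma> F" and "\<tau> = skew_flow \<sigma> F"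
    and "global_attractor D \<tau> A"
    and "\<forall>\<omega>. \<alpha> \<omega> \<le> \<beta> \<omega>" and "A = (\<Union>\<omega>. {\<omega>} \<times> {\<alpha> \<omega>..\<beta> \<omega>})"
    and "\<Omega>\<^sub>c = {\<omega>. isCont \<alpha> \<omega> \<and> isCont \<beta> \<omega>}"
  shows "(\<forall>\<omega>\<^sub>0\<in>\<Omega>\<^sub>c.
            minimal_set D \<tau> (graph_orbit_closure \<sigma> \<alpha> \<omega>\<^sub>0) \<and>
            minimal_set D \<tau> (graph_orbit_closure \<sigma> \<beta> \<omega>\<^sub>0) \<and>
            (\<forall>\<omega>\<in>\<Omega>\<^sub>c. graph_orbit_closure \<sigma> \<alpha> \<omega>\<^sub>0 `` {\<omega>} = {\<alpha> \<omega>} \<and>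
                    graph_orbit_closure \<sigma> \<beta> \<omega>\<^sub>0 `` {\<omega>} = {\<beta> \<omega>}) \<and>
            (\<forall>M. minimal_set D \<tau> M \<longrightarrow>
                 fiber_le (graph_orbit_closure \<sigma> \<alpha> \<omega>\<^sub>0) M \<and>
                 fiber_le M (graph_orbit_closure \<sigma> \<beta> \<omega>\<^sub>0))) \<and>
         (pinched D \<tau> A \<longleftrightarrow> (\<exists>\<omega>\<^sub>0\<in>\<Omega>\<^sub>c. \<alpha> \<omega>\<^sub>0 = \<beta> \<omega>\<^sub>0)) \<and>
         (pinched D \<tau> A \<longrightarrow> \<Omega>\<^sub>c = {\<omega>. \<alpha> \<omega> = \<beta> \<omega>})"
proof -
  note F_def = assms(11) and D_def = assms(12) and \<tau>_def = assms(13) and \<Omega>\<^sub>c_def = assms(17)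
  note attractor = assms(14) and order = assms(15) and A_def = assms(16)
  \<comment> \<open>The bound on \<open>a + g\<^sub>x\<close> over bounded \<open>x\<close> provides the Lipschitz constant.\<close>
  have "scalar_family \<sigma> F"
  proof
    show "continuous_on UNIV (\<lambda>(\<omega>, x). F \<omega> x)"
      unfolding F_def case_prod_beta using assms(4,5,7)
      by (auto intro!: continuous_intros continuous_on_compose2[of UNIV a] continuous_on_compose2[of UNIV b])
    fix R :: real
    have "compact ((UNIV :: 'w set) \<times> {- R..R})"
      using assms(1) by (intro compact_Times) auto
    moreover have "continuous_on (UNIV \<times> {- R..R}) (\<lambda>z. a (fst z) + g\<^sub>x z)"
      using assms(4,8)
      by (auto intro!: continuous_intros continuous_on_compose2[of UNIV a] intro: continuous_on_subset)
    ultimately have "bounded ((\<lambda>z. a (fst z) + g\<^sub>x z) ` (UNIV \<times> {- R..R}))"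
      by (intro compact_imp_bounded compact_continuous_image)
    then obtain L where "L > 0"
      and "\<forall>y \<in> (\<lambda>z. a (fst z) + g\<^sub>x z) ` (UNIV \<times> {- R..R}). norm y \<le> L"
      unfolding bounded_pos by blast
    then have L: "norm (a \<omega> + g\<^sub>x (\<omega>, x)) \<le> L" if "x \<in> {- R..R}" for \<omega> x
      using that by auto
    show "\<exists>L\<ge>0. \<forall>\<omega> x y. \<bar>x\<bar> \<le> R \<longrightarrow> \<bar>y\<bar> \<le> R \<longrightarrow> \<bar>F \<omega> x - F \<omega> y\<bar> \<le> L * \<bar>x - y\<bar>"
    proof (intro exI[of _ L] conjI allI impI)
      fix \<omega> x y assume "\<bar>x\<bar> \<le> R" "\<bar>y\<bar> \<le> R"
      then have xy: "x \<in> {- R..R}" "y \<in> {- R..R}" by auto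
      have "norm (F \<omega> x - F \<omega> y) \<le> L * norm (x - y)"
      proof (rule field_differentiable_bound[OF _ _ L xy])
        fix z
        show "(F \<omega> has_field_derivative a \<omega> + g\<^sub>x (\<omega>, z)) (at z within {- R..R})"
          unfolding F_def using assms(6)
          by (auto intro!: derivative_eq_intros intro: has_field_derivative_at_within)
      qed auto
      then show "\<bar>F \<omega> x - F \<omega> y\<bar> \<le> L * \<bar>x - y\<bar>" by simp
    qed (use \<open>L > 0\<close> in simp)
  qed (fact assms(1,2))+
  then interpret family: scalar_family \<sigma> F .
  interpret flow: scalar_skew_flow \<sigma> F A
    by unfold_locales
       (use assms(3) attractor in \<open>auto simp: global_attractor_def D_def \<tau>_def\<close>)
  interpret strip: fibre_interval_set \<sigma> F A \<alpha> \<beta>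
    by unfold_locales (use order in \<open>auto simp: A_def\<close>)
  have minimal_subset: "M \<subseteq> A" if "minimal_set D \<tau> M" for M
    using that bounded_invariant_subset_attractor[OF attractor, of M]
    by (auto simp: minimal_set_def compact_imp_bounded)
  have below: "fiber_le (graph_orbit_closure \<sigma> \<alpha> p) M"
    if "isCont \<alpha> p" "minimal_set D \<tau> M" for p M
    using strip.lower.graph_orbit_closure_extremal[OF that(1) that(2)[unfolded D_def \<tau>_def]
        minimal_subset[OF that(2)]]
    unfolding fiber_le_def fiber_less_def by auto
  have above: "fiber_le M (graph_orbit_closure \<sigma> \<beta> p)"
    if "isCont \<beta> p" "minimal_set D \<tau> M" for p M
    using strip.upper.graph_orbit_closure_extremal[OF that(1) that(2)[unfolded D_def \<tau>_def]
        minimal_subset[OF that(2)]]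
    unfolding fiber_le_def fiber_less_def by auto
  have pinched: "pinched D \<tau> A \<longleftrightarrow> (\<exists>\<omega>. \<alpha> \<omega> = \<beta> \<omega>)"
    unfolding D_def \<tau>_def by (rule strip.pinched_iff)
  have part_i: "\<forall>\<omega>\<^sub>0\<in>\<Omega>\<^sub>c.
            minimal_set D \<tau> (graph_orbit_closure \<sigma> \<alpha> \<omega>\<^sub>0) \<and>
            minimal_set D \<tau> (graph_orbit_closure \<sigma> \<beta> \<omega>\<^sub>0) \<and>
            (\<forall>\<omega>\<in>\<Omega>\<^sub>c. graph_orbit_closure \<sigma> \<alpha> \<omega>\<^sub>0 `` {\<omega>} = {\<alpha> \<omega>} \<and>
                    graph_orbit_closure \<sigma> \<beta> \<omega>\<^sub>0 `` {\<omega>} = {\<beta> \<omega>}) \<and>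
            (\<forall>M. minimal_set D \<tau> M \<longrightarrow>
                 fiber_le (graph_orbit_closure \<sigma> \<alpha> \<omega>\<^sub>0) M \<and>
                 fiber_le M (graph_orbit_closure \<sigma> \<beta> \<omega>\<^sub>0))"
    using strip.lower.minimal_graph_orbit_closure strip.upper.minimal_graph_orbit_closure
      strip.lower.section_at_continuity strip.upper.section_at_continuity below above
    by (simp add: \<Omega>\<^sub>c_def D_def \<tau>_def)
  have equal_imp: "\<omega> \<in> \<Omega>\<^sub>c" if "\<alpha> \<omega> = \<beta> \<omega>" for \<omega>
    using strip.isCont_if_equal[OF that] by (simp add: \<Omega>\<^sub>c_def)
  have "pinched D \<tau> A \<longleftrightarrow> (\<exists>\<omega>\<^sub>0\<in>\<Omega>\<^sub>c. \<alpha> \<omega>\<^sub>0 = \<beta> \<omega>\<^sub>0)"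
    using pinched equal_imp by blast
  moreover have "pinched D \<tau> A \<longrightarrow> \<Omega>\<^sub>c = {\<omega>. \<alpha> \<omega> = \<beta> \<omega>}"
    using pinched equal_imp strip.equal_if_isCont by (auto simp: \<Omega>\<^sub>c_def)
  ultimately show ?thesis using part_i by blast
qed

end
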